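(* Let $\psi$ be a $G_2$-structure on a $7$-manifold $M$ and let $\psi_t=A_t\psi$ be a family of $G_2$-structures on $M$ described by a smooth family of gauge deformations $A_t\in C^\infty(\mathrm{Aut}(TM))$. Let $\varphi_t$ be the $3$-form associated with $\psi_t$ and let $\mathcal{T}_t$ be the intrinsic torsion of $\psi_t$. Then $$\dot\psi_t=d\varphi_t\quad\Longleftrightarrow\quad D_{\psi_t}(\dot A_t\circ A_t^{-1})=D_{\psi_t}(\mathcal{T}_t),$$ where $D_{\psi_t}:\mathrm{End}(TM)\to\Lambda^4T^*M$ is defined by $D_{\psi_t}(A)=\left.\frac{d}{ds}\right|_{s=0}\exp(sA)\psi_t$.
   Context: Write $e^{ijk\ldots}=e^i\wedge e^j\wedge e^k\wedge\cdots$. A $G_2$-structure on an oriented $7$-manifold $M$ is a $4$-form $\psi$ such that every point has a positively oriented basis of the tangent space (a Cayley frame) in whose dual basis $\psi$ equals $\psi_0=e^{2345}+e^{2367}+e^{4567}-e^{1247}+e^{1357}-e^{1346}-e^{1256}$. Its metric $g$ is the one for which Cayley frames are orthonormal, and its associated $3$-form is $\varphi=\ast_g\psi$, which in a Cayley frame equals $\varphi_0=e^{246}-e^{356}-e^{347}-e^{257}+e^{123}+e^{145}+e^{167}$. The intrinsic torsion of the structure is the endomorphism field $\mathcal{T}\in C^\infty(\mathrm{End}(TM))$ defined by $\nabla^g_X\varphi=-(\mathcal{T}X)\lrcorner\psi$ for all $X\in TM$, where $\nabla^g$ is the Levi-Civita connection of $g$ and $Y\lrcorner\psi=\psi(Y,\cdot,\cdot,\cdot)$.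 A gauge deformation $A\in C^\infty(\mathrm{Aut}(TM))$ acts on forms by $(A\psi)(X_1,\ldots,X_4)=\psi(A^{-1}X_1,\ldots,A^{-1}X_4)$. A dot denotes $\partial/\partial t$. *)

theory Defs
  imports "HOL-Analysis.Analysis"
begin

section \<open>Smooth maps on open sets\<close>

text \<open>Only used on open sets. In finite dimension, requiring that all directional derivatives be
  of class \<open>C^k\<close> is the same as requiring this of the derivative.\<close>

primrec Ck_on :: "nat \<Rightarrow> ('a::real_normed_vector \<Rightarrow> 'b::real_normed_vector) \<Rightarrow> 'a set \<Rightarrow> bool" where
  "Ck_on 0 f S \<longleftrightarrow> continuous_on S f"
| "Ck_on (Suc k) f S \<longleftrightarrow>
    (\<exists>f'. (\<forall>x\<in>S. (f has_derivative f' x) (at x)) \<and> (\<forall>v. Ck_on k (\<lambda>x. f' x v) S))"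

definition smooth_on :: "('a::real_normed_vector \<Rightarrow> 'b::real_normed_vector) \<Rightarrow> 'a set \<Rightarrow> bool" where
  "smooth_on f S \<longleftrightarrow> (\<forall>k. Ck_on k f S)"


section \<open>Oriented smooth 7-manifolds\<close>

text \<open>A chart is a pair \<open>(U, x)\<close> of its domain and its coordinate map; the values of \<open>x\<close> outside
  \<open>U\<close> are irrelevant.\<close>

type_synonym 'm chart = "'m set \<times> ('m \<Rightarrow> real^7)"

definition is_chart :: "'m topology \<Rightarrow> 'm chart \<Rightarrow> bool" where
  "is_chart M c \<longleftrightarrow> openin M (fst c) \<and> open (snd c ` fst c) \<and>
     homeomorphic_map (subtopology M (fst c)) (top_of_set (snd c ` fst c)) (snd c)"

definition charts_at :: "'m chart set \<Rightarrow> 'm \<Rightarrow> 'm chart set" where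
  "charts_at \<A> p = {c \<in> \<A>. p \<in> fst c}"

definition chart_inv :: "'m chart \<Rightarrow> real^7 \<Rightarrow> 'm" where
  "chart_inv c = inv_into (fst c) (snd c)"

definition transition :: "'m chart \<Rightarrow> 'm chart \<Rightarrow> real^7 \<Rightarrow> real^7" where
  "transition c d = snd d \<circ> chart_inv c"

definition dtransition :: "'m chart \<Rightarrow> 'm chart \<Rightarrow> 'm \<Rightarrow> real^7 \<Rightarrow> real^7" where
  "dtransition c d p = frechet_derivative (transition c d) (at (snd c p))"

text \<open>The orientation of the manifold is the one given by the charts of the (oriented) atlas.\<close>

definition oriented_manifold7 :: "'m topology \<Rightarrow> 'm chart set \<Rightarrow> bool" where
  "oriented_manifold7 M \<A> \<longleftrightarrow>
     Hausdorff_space M \<and> second_countable M \<and>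
     (\<forall>c\<in>\<A>. is_chart M c) \<and> (\<Union>c\<in>\<A>. fst c) = topspace M \<and>
     (\<forall>c\<in>\<A>. \<forall>d\<in>\<A>. smooth_on (transition c d) (snd c ` (fst c \<inter> fst d))) \<and>
     (\<forall>p. \<forall>c\<in>charts_at \<A> p. \<forall>d\<in>charts_at \<A> p. det (matrix (dtransition c d p)) > 0)"

text \<open>The underlying point set, recovered from the atlas.\<close>

definition points :: "'m chart set \<Rightarrow> 'm set" where
  "points \<A> = (\<Union>c\<in>\<A>. fst c)"


section \<open>Tangent vectors and tensor fields\<close>

text \<open>A tangent vector \<open>X\<close> at \<open>p\<close> assigns to each chart \<open>c\<close> at \<open>p\<close> its coordinate vector \<open>X c\<close>,
  compatibly with the differentials of the transition maps. It is set to \<open>0\<close> on everything that is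
  not a chart at \<open>p\<close>, so that equality of functions is equality of tangent vectors.\<close>

type_synonym 'm tvec = "'m chart \<Rightarrow> real^7"

definition tangent_space :: "'m chart set \<Rightarrow> 'm \<Rightarrow> 'm tvec set" where
  "tangent_space \<A> p = {X. (\<forall>c. c \<notin> charts_at \<A> p \<longrightarrow> X c = 0) \<and>
     (\<forall>c\<in>charts_at \<A> p. \<forall>d\<in>charts_at \<A> p. X d = dtransition c d p (X c))}"

definition lincomb :: "real \<Rightarrow> 'm tvec \<Rightarrow> real \<Rightarrow> 'm tvec \<Rightarrow> 'm tvec" where
  "lincomb a X b Y = (\<lambda>c. a *\<^sub>R X c + b *\<^sub>R Y c)"

text \<open>The tangent vector at \<open>p\<close> with coordinate vector \<open>v\<close> in the chart \<open>c\<close>.\<close>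

definition coord_vec :: "'m chart set \<Rightarrow> 'm chart \<Rightarrow> 'm \<Rightarrow> real^7 \<Rightarrow> 'm tvec" where
  "coord_vec \<A> c p v = (\<lambda>d. if d \<in> charts_at \<A> p then dtransition c d p v else 0)"

text \<open>A covariant tensor field of rank \<open>k\<close> takes lists of \<open>k\<close> tangent vectors at a point; its
  values on other lists are irrelevant.\<close>

type_synonym 'm cotensor = "'m \<Rightarrow> 'm tvec list \<Rightarrow> real"

definition tlists :: "'m chart set \<Rightarrow> nat \<Rightarrow> 'm \<Rightarrow> 'm tvec list set" where
  "tlists \<A> k p = {Xs. length Xs = k \<and> set Xs \<subseteq> tangent_space \<A> p}"

definition local_rep :: "'m chart set \<Rightarrow> 'm chart \<Rightarrow> 'm cotensor \<Rightarrow> (real^7) list \<Rightarrow> real^7 \<Rightarrow> real" where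
  "local_rep \<A> c \<omega> vs x = \<omega> (chart_inv c x) (map (coord_vec \<A> c (chart_inv c x)) vs)"

definition tensor_field :: "'m chart set \<Rightarrow> nat \<Rightarrow> 'm cotensor \<Rightarrow> bool" where
  "tensor_field \<A> k \<omega> \<longleftrightarrow>
     (\<forall>p\<in>points \<A>. \<forall>Xs\<in>tlists \<A> k p. \<forall>i<k. \<forall>X\<in>tangent_space \<A> p. \<forall>Y\<in>tangent_space \<A> p. \<forall>a b.
        \<omega> p (Xs[i := lincomb a X b Y]) = a * \<omega> p (Xs[i := X]) + b * \<omega> p (Xs[i := Y])) \<and>
     (\<forall>c\<in>\<A>. \<forall>vs. length vs = k \<longrightarrow> smooth_on (local_rep \<A> c \<omega> vs) (snd c ` fst c))"

definition diff_form :: "'m chart set \<Rightarrow> nat \<Rightarrow> 'm cotensor \<Rightarrow> bool" where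
  "diff_form \<A> k \<omega> \<longleftrightarrow> tensor_field \<A> k \<omega> \<and>
     (\<forall>p\<in>points \<A>. \<forall>Xs\<in>tlists \<A> k p. \<not> distinct Xs \<longrightarrow> \<omega> p Xs = 0)"

definition form_eq :: "'m chart set \<Rightarrow> nat \<Rightarrow> 'm cotensor \<Rightarrow> 'm cotensor \<Rightarrow> bool" where
  "form_eq \<A> k \<alpha> \<beta> \<longleftrightarrow> (\<forall>p\<in>points \<A>. \<forall>Xs\<in>tlists \<A> k p. \<alpha> p Xs = \<beta> p Xs)"

text \<open>Endomorphisms of the tangent spaces; only their values on tangent vectors matter.\<close>

type_synonym 'm endo = "'m \<Rightarrow> 'm tvec \<Rightarrow> 'm tvec"

definition pointwise_endo :: "'m chart set \<Rightarrow> 'm endo \<Rightarrow> bool" where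
  "pointwise_endo \<A> E \<longleftrightarrow>
     (\<forall>p\<in>points \<A>. \<forall>X\<in>tangent_space \<A> p. E p X \<in> tangent_space \<A> p) \<and>
     (\<forall>p\<in>points \<A>. \<forall>X\<in>tangent_space \<A> p. \<forall>Y\<in>tangent_space \<A> p. \<forall>a b.
        E p (lincomb a X b Y) = lincomb a (E p X) b (E p Y))"

definition endo_rep :: "'m chart set \<Rightarrow> 'm chart \<Rightarrow> 'm endo \<Rightarrow> real^7 \<Rightarrow> real^7 \<Rightarrow> real^7" where
  "endo_rep \<A> c E v x = E (chart_inv c x) (coord_vec \<A> c (chart_inv c x) v) c"

definition endo_field :: "'m chart set \<Rightarrow> 'm endo \<Rightarrow> bool" where
  "endo_field \<A> E \<longleftrightarrow> pointwise_endo \<A> E \<and>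
     (\<forall>c\<in>\<A>. \<forall>v. smooth_on (endo_rep \<A> c E v) (snd c ` fst c))"

text \<open>Smoothness of a family of gauge deformations is joint smoothness in time and position.\<close>

definition gauge_family :: "'m chart set \<Rightarrow> real set \<Rightarrow> (real \<Rightarrow> 'm endo) \<Rightarrow> bool" where
  "gauge_family \<A> I A \<longleftrightarrow>
     (\<forall>t\<in>I. pointwise_endo \<A> (A t) \<and>
        (\<forall>p\<in>points \<A>. bij_betw (A t p) (tangent_space \<A> p) (tangent_space \<A> p))) \<and>
     (\<forall>c\<in>\<A>. \<forall>v. smooth_on (\<lambda>(t, x). endo_rep \<A> c (A t) v x) (I \<times> (snd c ` fst c)))"

definition gauge_inv :: "'m chart set \<Rightarrow> 'm endo \<Rightarrow> 'm endo" where
  "gauge_inv \<A> A p = inv_into (tangent_space \<A> p) (A p)"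

definition gauge_act :: "'m chart set \<Rightarrow> 'm endo \<Rightarrow> 'm cotensor \<Rightarrow> 'm cotensor" where
  "gauge_act \<A> A \<omega> p Xs = \<omega> p (map (gauge_inv \<A> A p) Xs)"

definition endo_compose :: "'m endo \<Rightarrow> 'm endo \<Rightarrow> 'm endo" where
  "endo_compose E F p = E p \<circ> F p"

definition endo_scale :: "real \<Rightarrow> 'm endo \<Rightarrow> 'm endo" where
  "endo_scale s E p X = (\<lambda>c. s *\<^sub>R E p X c)"

definition endo_exp :: "'m endo \<Rightarrow> 'm endo" where
  "endo_exp E p X = (\<lambda>c. \<Sum>n. (1 / fact n) *\<^sub>R ((E p ^^ n) X c))"

definition endo_dot :: "(real \<Rightarrow> 'm endo) \<Rightarrow> real \<Rightarrow> 'm endo" where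
  "endo_dot A t p X = (\<lambda>c. vector_derivative (\<lambda>s. A s p X c) (at t))"

definition form_dot :: "(real \<Rightarrow> 'm cotensor) \<Rightarrow> real \<Rightarrow> 'm cotensor" where
  "form_dot \<psi> t p Xs = deriv (\<lambda>s. \<psi> s p Xs) t"

definition D_op :: "'m chart set \<Rightarrow> 'm cotensor \<Rightarrow> 'm endo \<Rightarrow> 'm cotensor" where
  "D_op \<A> \<psi> E p Xs = deriv (\<lambda>s. gauge_act \<A> (endo_exp (endo_scale s E)) \<psi> p Xs) 0"


section \<open>Exterior derivative and covariant derivative\<close>

text \<open>Both are given by their coordinate expressions at \<open>p\<close> in an arbitrarily selected chart
  around \<open>p\<close>; the results do not depend on the selected chart.\<close>

definition chart_at :: "'m chart set \<Rightarrow> 'm \<Rightarrow> 'm chart" where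
  "chart_at \<A> p = (SOME c. c \<in> charts_at \<A> p)"

definition ext_deriv :: "'m chart set \<Rightarrow> 'm cotensor \<Rightarrow> 'm cotensor" where
  "ext_deriv \<A> \<omega> p Xs = (let c = chart_at \<A> p in
     \<Sum>i<length Xs. (-1) ^ i *
       frechet_derivative (local_rep \<A> c \<omega> (map (\<lambda>X. X c) (take i Xs @ drop (Suc i) Xs)))
         (at (snd c p)) ((Xs ! i) c))"

text \<open>An affine connection is given by its Christoffel symbols: in the chart \<open>c\<close>,
  \<open>\<nabla>\<^sub>X Y = D Y (X) + \<Gamma> c p X Y\<close>. The last condition is their transformation law, which says that the
  vector \<open>\<nabla>\<^sub>X Y\<close> does not depend on the chart.\<close>

type_synonym 'm christoffel = "'m chart \<Rightarrow> 'm \<Rightarrow> real^7 \<Rightarrow> real^7 \<Rightarrow> real^7"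

definition affine_connection :: "'m chart set \<Rightarrow> 'm christoffel \<Rightarrow> bool" where
  "affine_connection \<A> \<Gamma> \<longleftrightarrow>
     (\<forall>c\<in>\<A>. \<forall>p\<in>fst c. bilinear (\<Gamma> c p)) \<and>
     (\<forall>c\<in>\<A>. \<forall>u v. smooth_on (\<lambda>x. \<Gamma> c (chart_inv c x) u v) (snd c ` fst c)) \<and>
     (\<forall>p. \<forall>c\<in>charts_at \<A> p. \<forall>d\<in>charts_at \<A> p. \<forall>u v.
        dtransition c d p (\<Gamma> c p u v) =
          frechet_derivative (\<lambda>x. frechet_derivative (transition c d) (at x) v) (at (snd c p)) u
          + \<Gamma> d p (dtransition c d p u) (dtransition c d p v))"

definition cov_deriv :: "'m chart set \<Rightarrow> 'm christoffel \<Rightarrow> 'm cotensor \<Rightarrow> 'm \<Rightarrow> 'm tvec \<Rightarrow> 'm tvec list \<Rightarrow> real"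
  where
  "cov_deriv \<A> \<Gamma> \<omega> p X Ys = (let c = chart_at \<A> p in
     frechet_derivative (local_rep \<A> c \<omega> (map (\<lambda>Y. Y c) Ys)) (at (snd c p)) (X c)
     - (\<Sum>i<length Ys. \<omega> p (Ys[i := coord_vec \<A> c p (\<Gamma> c p (X c) ((Ys ! i) c))])))"

definition riemannian_metric :: "'m chart set \<Rightarrow> 'm cotensor \<Rightarrow> bool" where
  "riemannian_metric \<A> g \<longleftrightarrow> tensor_field \<A> 2 g \<and>
     (\<forall>p\<in>points \<A>. \<forall>X\<in>tangent_space \<A> p. \<forall>Y\<in>tangent_space \<A> p. g p [X, Y] = g p [Y, X]) \<and>
     (\<forall>p\<in>points \<A>. \<forall>X\<in>tangent_space \<A> p. X \<noteq> (\<lambda>c. 0) \<longrightarrow> g p [X, X] > 0)"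

text \<open>The torsion-free affine connection with \<open>\<nabla>g = 0\<close>.\<close>

definition levi_civita :: "'m chart set \<Rightarrow> 'm cotensor \<Rightarrow> 'm christoffel \<Rightarrow> bool" where
  "levi_civita \<A> g \<Gamma> \<longleftrightarrow> affine_connection \<A> \<Gamma> \<and>
     (\<forall>c\<in>\<A>. \<forall>p\<in>fst c. \<forall>u v. \<Gamma> c p u v = \<Gamma> c p v u) \<and>
     (\<forall>p\<in>points \<A>. \<forall>X\<in>tangent_space \<A> p. \<forall>Ys\<in>tlists \<A> 2 p. cov_deriv \<A> \<Gamma> g p X Ys = 0)"


section \<open>\<open>G\<^sub>2\<close>-structures\<close>

text \<open>The form \<open>e^{i\<^sub>1 \<dots> i\<^sub>k}\<close> on \<open>\<real>^7\<close>, normalised so that it is \<open>1\<close> on \<open>e\<^bsub>i\<^sub>1\<^esub>, \<dots>, e\<^bsub>i\<^sub>k\<^esub>\<close>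
  when the indices are distinct. In the index type, the numeral \<open>7\<close> equals \<open>0\<close>.\<close>

definition basis_form :: "7 list \<Rightarrow> (real^7) list \<Rightarrow> real" where
  "basis_form is vs = (\<Sum>\<sigma> | \<sigma> permutes {..<length is}.
     of_int (sign \<sigma>) * (\<Prod>r<length is. (vs ! \<sigma> r) $ (is ! r)))"

definition psi0 :: "(real^7) list \<Rightarrow> real" where
  "psi0 vs = basis_form [2,3,4,5] vs + basis_form [2,3,6,7] vs + basis_form [4,5,6,7] vs
     - basis_form [1,2,4,7] vs + basis_form [1,3,5,7] vs - basis_form [1,3,4,6] vs
     - basis_form [1,2,5,6] vs"

definition positive_frame :: "'m chart set \<Rightarrow> 'm \<Rightarrow> (7 \<Rightarrow> 'm tvec) \<Rightarrow> bool" where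
  "positive_frame \<A> p e \<longleftrightarrow> (\<forall>i. e i \<in> tangent_space \<A> p) \<and>
     (\<forall>c\<in>charts_at \<A> p. det (\<chi> i. e i c) > 0)"

definition cayley_frame :: "'m chart set \<Rightarrow> 'm cotensor \<Rightarrow> 'm \<Rightarrow> (7 \<Rightarrow> 'm tvec) \<Rightarrow> bool" where
  "cayley_frame \<A> \<psi> p e \<longleftrightarrow> positive_frame \<A> p e \<and>
     (\<forall>is. length is = 4 \<longrightarrow> \<psi> p (map e is) = psi0 (map (\<lambda>i. axis i 1) is))"

definition g2_structure :: "'m chart set \<Rightarrow> 'm cotensor \<Rightarrow> bool" where
  "g2_structure \<A> \<psi> \<longleftrightarrow> diff_form \<A> 4 \<psi> \<and> (\<forall>p\<in>points \<A>. \<exists>e. cayley_frame \<A> \<psi> p e)"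

definition orthonormal :: "'m cotensor \<Rightarrow> 'm \<Rightarrow> (7 \<Rightarrow> 'm tvec) \<Rightarrow> bool" where
  "orthonormal g p e \<longleftrightarrow> (\<forall>i j. g p [e i, e j] = (if i = j then 1 else 0))"

definition g2_metric :: "'m chart set \<Rightarrow> 'm cotensor \<Rightarrow> 'm cotensor \<Rightarrow> bool" where
  "g2_metric \<A> \<psi> g \<longleftrightarrow> riemannian_metric \<A> g \<and>
     (\<forall>p\<in>points \<A>. \<forall>e. cayley_frame \<A> \<psi> p e \<longrightarrow> orthonormal g p e)"

text \<open>\<open>\<phi>\<close> is the Hodge dual of the 4-form \<open>\<psi>\<close>. As \<open>\<ast>e^{1234} = e^{567}\<close> for every positively oriented
  orthonormal frame, \<open>(\<ast>\<psi>)(e\<^sub>5, e\<^sub>6, e\<^sub>7) = \<psi>(e\<^sub>1, e\<^sub>2, e\<^sub>3, e\<^sub>4)\<close> for all these frames; applied to the even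
  rearrangements of one frame, this gives all components of \<open>\<ast>\<psi>\<close>.\<close>

definition hodge_dual4 :: "'m chart set \<Rightarrow> 'm cotensor \<Rightarrow> 'm cotensor \<Rightarrow> 'm cotensor \<Rightarrow> bool" where
  "hodge_dual4 \<A> g \<psi> \<phi> \<longleftrightarrow> diff_form \<A> 3 \<phi> \<and>
     (\<forall>p\<in>points \<A>. \<forall>e. positive_frame \<A> p e \<and> orthonormal g p e \<longrightarrow>
        \<phi> p [e 5, e 6, e 7] = \<psi> p [e 1, e 2, e 3, e 4])"

definition contract :: "'m tvec \<Rightarrow> 'm cotensor \<Rightarrow> 'm \<Rightarrow> 'm tvec list \<Rightarrow> real" where
  "contract Y \<psi> p Xs = \<psi> p (Y # Xs)"

definition intrinsic_torsion ::
    "'m chart set \<Rightarrow> 'm cotensor \<Rightarrow> 'm cotensor \<Rightarrow> 'm cotensor \<Rightarrow> 'm endo \<Rightarrow> bool" where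
  "intrinsic_torsion \<A> \<psi> g \<phi> T \<longleftrightarrow> endo_field \<A> T \<and>
     (\<exists>\<Gamma>. levi_civita \<A> g \<Gamma> \<and>
       (\<forall>p\<in>points \<A>. \<forall>X\<in>tangent_space \<A> p. \<forall>Ys\<in>tlists \<A> 3 p.
          cov_deriv \<A> \<Gamma> \<phi> p X Ys = - contract (T p X) \<psi> p Ys))"

end

theory Submission
  imports Defs
begin

text \<open>Both sides of the equivalence compare the same two forms, because each of the two sides of the
  flow equation is a value of \<open>D\<close>:
  \<open>\<psi>\<^sub>t\<close> has time derivative \<open>D (A' A\<^sup>-\<^sup>1)\<close> and \<open>d \<phi>\<^sub>t = D T\<^sub>t\<close>, where \<open>D\<close> is taken at \<open>\<psi>\<^sub>t\<close> and \<open>A'\<close> is the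
  time derivative of \<open>A\<close>.

  The operator \<open>D\<close> is minus the derivation action of endomorphisms on forms,
  \<open>D E (X\<^sub>1, \<dots>, X\<^sub>4) = - \<Sum>\<^sub>i \<psi> (X\<^sub>1, \<dots>, E X\<^sub>i, \<dots>, X\<^sub>4)\<close> (lemma \<open>D_op_eq\<close>). This and the first identity
  (lemma \<open>gauge_act_has_derivative\<close>) are the same computation for two families \<open>B\<^sub>s\<close> of automorphisms
  of one tangent space, \<open>exp (s E)\<close> at \<open>s = 0\<close> and \<open>A\<^sub>s\<close> at \<open>s = t\<close>: the inverses of \<open>B\<^sub>s\<close> have the
  derivative \<open>- B\<^sup>-\<^sup>1 B' B\<^sup>-\<^sup>1\<close>, and the product rule for multilinear maps inserts it into each slot of
  the form in turn (lemma \<open>gauge_inv_has_derivative\<close>). A chart turns this into a statement about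
  matrices.

  For the second identity, \<open>d \<phi>\<close> is the alternation of \<open>\<nabla>\<phi>\<close> for every torsion-free connection,
  because the Christoffel terms cancel in pairs (lemma \<open>ext_deriv_eq_cov_deriv\<close>). Inserting
  \<open>\<nabla>\<^sub>X \<phi> = - \<psi> (T X, \<cdot>, \<cdot>, \<cdot>)\<close> and moving \<open>T X\<^sub>i\<close> back to the slot \<open>i\<close>, which produces exactly the sign
  of the alternation, gives \<open>d \<phi> = D T\<close> (lemma \<open>ext_deriv_eq_D_op_torsion\<close>).\<close>

section \<open>Product rule for multilinear functions of lists\<close>

lemma axis_expansion: "(\<Sum>j\<in>UNIV. v $ j *\<^sub>R axis j 1) = (v :: real^'n)"
  using basis_expansion[of v] by (simp add: scalar_mult_eq_scaleR)

definition multilinear :: "nat \<Rightarrow> ((real^'n) list \<Rightarrow> real) \<Rightarrow> bool" where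
  "multilinear k F \<longleftrightarrow> (\<forall>vs i. length vs = k \<and> i < k \<longrightarrow> linear (\<lambda>v. F (vs[i := v])))"

lemma multilinear_Cons:
  fixes v :: "real^'n"
  assumes "multilinear (Suc k) F"
  shows "multilinear k (\<lambda>vs. F (v # vs))"
  unfolding multilinear_def
proof (intro allI impI)
  fix vs :: "(real^'n) list" and i assume "length vs = k \<and> i < k"
  then have "linear (\<lambda>w. F ((v # vs)[Suc i := w]))"
    using assms unfolding multilinear_def by (metis Suc_less_eq length_Cons)
  then show "linear (\<lambda>w. F (v # vs[i := w]))" by simp
qed

lemma multilinear_expand_hd:
  fixes v :: "real^'n"
  assumes "multilinear (Suc (length vs)) F"
  shows "F (v # vs) = (\<Sum>j\<in>UNIV. v $ j * F (axis j 1 # vs))"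
proof -
  have lin: "linear (\<lambda>v. F ((undefined # vs)[0 := v]))"
    using assms unfolding multilinear_def by (metis length_Cons zero_less_Suc)
  then have lin: "linear (\<lambda>v. F (v # vs))" by simp
  have "F (v # vs) = F ((\<Sum>j\<in>UNIV. v $ j *\<^sub>R axis j 1) # vs)"
    by (simp only: axis_expansion)
  also have "\<dots> = (\<Sum>j\<in>UNIV. v $ j * F (axis j 1 # vs))"
    by (simp add: linear_sum[OF lin] linear_scale[OF lin])
  finally show ?thesis .
qed

text \<open>Induction on the number of arguments. Expanding the first argument in the standard basis writes
  \<open>F\<close> as a sum of products of a real coordinate with a function of the remaining arguments, so that
  only the product rule for real functions is needed.\<close>

lemma multilinear_has_derivative:
  fixes Y :: "real \<Rightarrow> 'x \<Rightarrow> real^'n"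
  assumes "multilinear (length xs) F"
    and "\<And>x. x \<in> set xs \<Longrightarrow> ((\<lambda>s. Y s x) has_vector_derivative Y' x) (at t)"
  shows "((\<lambda>s. F (map (Y s) xs)) has_real_derivative
           (\<Sum>i<length xs. F ((map (Y t) xs)[i := Y' (xs ! i)]))) (at t)"
  using assms
proof (induction xs arbitrary: F)
  case Nil
  then show ?case by simp
next
  case (Cons x xs)
  let ?V = "map (Y t) xs"
  have ml: "multilinear (length xs) (\<lambda>vs. F (v # vs))" for v
    using Cons.prems(1) multilinear_Cons by simp
  have ex: "F (v # vs) = (\<Sum>j\<in>UNIV. v $ j * F (axis j 1 # vs))" if "length vs = length xs" for v vs
    using multilinear_expand_hd[of vs F v] Cons.prems(1) that by simp
  have comp: "((\<lambda>s. Y s x $ j) has_real_derivative Y' x $ j) (at t)" for j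
    using bounded_linear.has_vector_derivative[OF bounded_linear_vec_nth[of j] Cons.prems(2)[of x]]
    by (simp add: has_real_derivative_iff_has_vector_derivative)
  have rest: "((\<lambda>s. F (v # map (Y s) xs)) has_real_derivative
                 (\<Sum>i<length xs. F (v # ?V[i := Y' (xs ! i)]))) (at t)" for v
    using Cons.IH[OF ml] Cons.prems(2) by simp
  have "((\<lambda>s. \<Sum>j\<in>UNIV. Y s x $ j * F (axis j 1 # map (Y s) xs)) has_real_derivative
          (\<Sum>j\<in>UNIV. Y' x $ j * F (axis j 1 # ?V)
             + (\<Sum>i<length xs. F (axis j 1 # ?V[i := Y' (xs ! i)])) * Y t x $ j)) (at t)"
    by (intro DERIV_sum DERIV_mult comp rest)
  also have "(\<Sum>j\<in>UNIV. Y' x $ j * F (axis j 1 # ?V)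
               + (\<Sum>i<length xs. F (axis j 1 # ?V[i := Y' (xs ! i)])) * Y t x $ j)
           = F (Y' x # ?V) + (\<Sum>i<length xs. \<Sum>j\<in>UNIV. Y t x $ j * F (axis j 1 # ?V[i := Y' (xs ! i)]))"
    by (subst sum.swap) (simp add: sum.distrib ex[of ?V "Y' x"] sum_distrib_left mult.commute)
  also have "\<dots> = F (Y' x # ?V) + (\<Sum>i<length xs. F (Y t x # ?V[i := Y' (xs ! i)]))"
    by (simp flip: ex)
  also have "\<dots> = (\<Sum>i<length (x # xs). F ((map (Y t) (x # xs))[i := Y' ((x # xs) ! i)]))"
    by (simp add: sum.lessThan_Suc_shift del: sum.lessThan_Suc)
  finally show ?case by (simp only: list.map(2) ex[OF length_map, symmetric])
qed

section \<open>Derivative of the inverse of a family of linear maps\<close>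

lemma differentiable_det:
  fixes N :: "real \<Rightarrow> real^'n^'n"
  assumes "\<And>i j. (\<lambda>s. N s $ i $ j) differentiable (at t)"
  shows "(\<lambda>s. det (N s)) differentiable (at t)"
proof -
  obtain n' where n': "\<And>i j. ((\<lambda>s. N s $ i $ j) has_real_derivative n' i j) (at t)"
    using assms unfolding real_differentiable_def by metis
  have "(\<lambda>s. \<Prod>i\<in>UNIV. N s $ i $ p i) differentiable (at t)" for p
    unfolding real_differentiable_def by (rule exI) (rule has_field_derivative_prod, rule n')
  then show ?thesis
    unfolding det_def by (intro differentiable_sum differentiable_mult differentiable_const finite_permutations) auto
qed

text \<open>Only the existence of a derivative of \<open>L\<^sub>s\<^sup>-\<^sup>1 v\<close> needs an argument: by Cramer's rule its coordinates
  are quotients of determinants. Its value then follows by differentiating \<open>L\<^sub>s (L\<^sub>s\<^sup>-\<^sup>1 v) = v\<close>.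
  Differentiability of \<open>L\<close> is assumed at each vector only, which in finite dimension is the same as
  differentiability of the matrices.\<close>

lemma inverse_family_has_derivative:
  fixes L :: "real \<Rightarrow> real^'n \<Rightarrow> real^'n"
  assumes lin: "eventually (\<lambda>s. linear (L s)) (nhds t)"
    and bij: "bij (L t)"
    and der: "\<And>v. ((\<lambda>s. L s v) has_vector_derivative L' v) (at t)"
  shows "eventually (\<lambda>s. bij (L s)) (nhds t)"
    and "((\<lambda>s. inv (L s) v) has_vector_derivative - inv (L t) (L' (inv (L t) v))) (at t)"
proof -
  have cong: "(f has_vector_derivative f') (at t) \<longleftrightarrow> (g has_vector_derivative f') (at t)"
    if "eventually (\<lambda>s. f s = g s) (nhds t)" for f g :: "real \<Rightarrow> real^'n" and f'
    using eventually_nhds_x_imp_x[OF that] that by (intro has_vector_derivative_cong_ev) simp_all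
  define N where "N s = matrix (L s)" for s
  have linT: "linear (L t)" by (rule eventually_nhds_x_imp_x[OF lin])
  have comp: "((\<lambda>s. N s $ i $ j) has_real_derivative L' (axis j 1) $ i) (at t)" for i j
    using bounded_linear.has_vector_derivative[OF bounded_linear_vec_nth[of i] der[of "axis j 1"]]
    by (simp add: N_def matrix_def has_real_derivative_iff_has_vector_derivative)
  have diffN: "(\<lambda>s. N s $ i $ j) differentiable (at t)" for i j
    using comp real_differentiable_def by blast
  have ddet: "(\<lambda>s. det (N s)) differentiable (at t)"
    by (intro differentiable_det diffN)
  have det_bij: "det (N s) \<noteq> 0 \<longleftrightarrow> bij (L s)" if "linear (L s)" for s
    using that unfolding N_def
    by (simp add: invertible_eq_bij matrix_works flip: invertible_det_nz)
  have "continuous (at t) (\<lambda>s. det (N s))"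
    by (rule differentiable_imp_continuous_within[OF ddet])
  then have "((\<lambda>s. det (N s)) \<longlongrightarrow> det (N t)) (nhds t)"
    by (simp add: isCont_def tendsto_nhds_iff)
  moreover have nz: "det (N t) \<noteq> 0" using det_bij[OF linT] bij by simp
  ultimately have ev: "eventually (\<lambda>s. det (N s) \<noteq> 0) (nhds t)"
    by (rule tendsto_imp_eventually_ne)
  show evb: "eventually (\<lambda>s. bij (L s)) (nhds t)"
    using ev lin by eventually_elim (use det_bij in blast)
  \<comment> \<open>\<open>W s\<close> is the solution of \<open>L s w = v\<close> given by Cramer's rule.\<close>
  define W where "W s = (\<chi> k. det (\<chi> i j. if j = k then v $ i else N s $ i $ j) / det (N s))" for s
  have evW: "eventually (\<lambda>s. inv (L s) v = W s) (nhds t)"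
    using ev lin
  proof eventually_elim
    case (elim s)
    then have "N s *v inv (L s) v = v"
      using det_bij by (simp add: N_def bij_is_surj surj_f_inv_f matrix_works)
    then show ?case unfolding W_def using cramer[of "N s" "inv (L s) v" v] elim by simp
  qed
  have "(\<lambda>s. if j = k then v $ i else N s $ i $ j) differentiable (at t)" for i j k
    by (cases "j = k") (simp_all add: diffN)
  then have "(\<lambda>s. W s $ k) differentiable (at t)" for k
    unfolding W_def vec_lambda_beta
    by (intro differentiable_divide differentiable_det nz) (simp_all add: diffN)
  then obtain w' where w': "\<And>k. ((\<lambda>s. W s $ k) has_real_derivative w' k) (at t)"
    unfolding real_differentiable_def by metis
  define W' where "W' = (\<chi> k. w' k)"
  have W': "((\<lambda>s. W s $ k) has_real_derivative W' $ k) (at t)" for k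
    using w' by (simp add: W'_def)
  have dW: "(W has_vector_derivative W') (at t)"
  proof -
    have "((\<lambda>s. \<Sum>k\<in>UNIV. W s $ k *\<^sub>R axis k (1::real)) has_vector_derivative
            (\<Sum>k\<in>UNIV. W' $ k *\<^sub>R axis k 1)) (at t)"
      by (intro has_vector_derivative_sum) (auto intro!: derivative_eq_intros W')
    then show ?thesis
      by (simp only: axis_expansion)
  qed
  have invW: "((\<lambda>s. inv (L s) v) has_vector_derivative W') (at t)"
    using dW cong[OF evW] by simp
  have exp: "L s u = (\<Sum>j\<in>UNIV. u $ j *\<^sub>R L s (axis j 1))" if "linear (L s)" for s u
  proof -
    have "L s u = L s (\<Sum>j\<in>UNIV. u $ j *\<^sub>R axis j 1)"
      by (simp only: axis_expansion)
    then show ?thesis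
      by (simp add: linear_sum[OF that] linear_scale[OF that])
  qed
  have dexp: "((\<lambda>s. L s (U s)) has_vector_derivative
      (\<Sum>j\<in>UNIV. U' $ j *\<^sub>R L t (axis j 1)) + (\<Sum>j\<in>UNIV. U t $ j *\<^sub>R L' (axis j 1))) (at t)"
    if "(U has_vector_derivative U') (at t)" for U U'
  proof -
    have U: "((\<lambda>s. U s $ j) has_real_derivative U' $ j) (at t)" for j
      using bounded_linear.has_vector_derivative[OF bounded_linear_vec_nth[of j] that]
      by (simp add: has_real_derivative_iff_has_vector_derivative)
    have "((\<lambda>s. \<Sum>j\<in>UNIV. U s $ j *\<^sub>R L s (axis j 1)) has_vector_derivative
      (\<Sum>j\<in>UNIV. U t $ j *\<^sub>R L' (axis j 1) + U' $ j *\<^sub>R L t (axis j 1))) (at t)"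
      by (intro has_vector_derivative_sum has_vector_derivative_scaleR U der)
    moreover have "eventually (\<lambda>s. L s (U s) = (\<Sum>j\<in>UNIV. U s $ j *\<^sub>R L s (axis j 1))) (nhds t)"
      using lin by eventually_elim (rule exp)
    ultimately show ?thesis
      using cong by (simp add: sum.distrib add.commute)
  qed
  have L'exp: "L' u = (\<Sum>j\<in>UNIV. u $ j *\<^sub>R L' (axis j 1))" for u
    using vector_derivative_unique_at[OF der[of u] dexp[of "\<lambda>_. u" 0]] by simp
  have "((\<lambda>s. L s (W s)) has_vector_derivative L t W' + L' (W t)) (at t)"
    using dexp[OF dW] by (simp flip: L'exp exp[OF linT])
  moreover have "((\<lambda>s. L s (W s)) has_vector_derivative 0) (at t)"
  proof -
    have "eventually (\<lambda>s. L s (W s) = v) (nhds t)"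
      using evb evW
    proof eventually_elim
      case (elim s)
      then show ?case using surj_f_inv_f[OF bij_is_surj, of "L s" v] by simp
    qed
    then show ?thesis
      using cong by simp
  qed
  ultimately have "L' (W t) + L t W' = 0"
    using vector_derivative_unique_at by (metis add.commute)
  then have "L t W' = - L' (inv (L t) v)"
    using eventually_nhds_x_imp_x[OF evW] by (simp add: eq_neg_iff_add_eq_0 add.commute)
  also have "\<dots> = L t (- inv (L t) (L' (inv (L t) v)))"
    by (simp add: linear_neg[OF linT] surj_f_inv_f[OF bij_is_surj[OF bij]])
  finally have "W' = - inv (L t) (L' (inv (L t) v))"
    by (rule injD[OF bij_is_inj[OF bij]])
  with invW show "((\<lambda>s. inv (L s) v) has_vector_derivative - inv (L t) (L' (inv (L t) v))) (at t)"
    by simp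
qed

section \<open>The exponential series of a linear map\<close>

lemma linear_funpow:
  fixes L :: "'a::real_vector \<Rightarrow> 'a"
  assumes "linear L"
  shows "linear (L ^^ n)"
  by (induction n) (simp_all add: linear_iff linear_add[OF assms] linear_scale[OF assms])

lemma scaled_funpow:
  fixes L :: "'a::real_vector \<Rightarrow> 'a"
  assumes "linear L"
  shows "((\<lambda>x. s *\<^sub>R L x) ^^ n) v = s ^ n *\<^sub>R (L ^^ n) v"
  by (induction n) (simp_all add: linear_scale[OF assms])

lemma exp_series_summable:
  fixes L :: "'a::euclidean_space \<Rightarrow> 'a"
  assumes "linear L"
  shows "summable (\<lambda>n. (1 / fact n) *\<^sub>R (L ^^ n) v)"
proof -
  obtain K where "K > 0" and K: "\<And>x. norm (L x) \<le> K * norm x"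
    using linear_bounded_pos[OF assms] by blast
  have pow: "norm ((L ^^ n) v) \<le> K ^ n * norm v" for n
  proof (induction n)
    case (Suc n)
    then show ?case
      using order_trans[OF K[of "(L ^^ n) v"] mult_left_mono[OF Suc, of K]] \<open>K > 0\<close>
      by (simp add: mult.assoc)
  qed simp
  have "summable (\<lambda>n. (inverse (fact n) * K ^ n) * norm v)"
    by (intro summable_mult2 summable_exp)
  then show ?thesis
  proof (rule summable_comparison_test')
    show "norm ((1 / fact n) *\<^sub>R (L ^^ n) v) \<le> inverse (fact n) * K ^ n * norm v" for n
      using pow[of n] by (simp add: field_simps)
  qed
qed

text \<open>Each coordinate of \<open>exp (s L) v\<close> is a power series in \<open>s\<close> that converges everywhere. Its
  derivative at \<open>0\<close> is the coefficient of \<open>s\<close>, a coordinate of \<open>L v\<close>.\<close>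

lemma exp_series_has_derivative_at_0:
  fixes L :: "real^'n \<Rightarrow> real^'n"
  assumes "linear L"
  shows "((\<lambda>s. \<Sum>n. (1 / fact n) *\<^sub>R ((\<lambda>x. s *\<^sub>R L x) ^^ n) v) has_vector_derivative L v) (at 0)"
proof -
  define a where "a k n = (1 / fact n) * ((L ^^ n) v $ k)" for k n
  have scaled: "linear (\<lambda>x. s *\<^sub>R L x)" for s
    using assms by (intro linear_compose_scale_right)
  have summ: "summable (\<lambda>n. (1 / fact n) *\<^sub>R ((\<lambda>x. s *\<^sub>R L x) ^^ n) v)" for s
    by (rule exp_series_summable[OF scaled])
  have comp: "((1 / fact n) *\<^sub>R ((\<lambda>x. s *\<^sub>R L x) ^^ n) v) $ k = a k n * s ^ n" for n s k
    by (simp add: scaled_funpow[OF assms] a_def)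
  have suma: "summable (\<lambda>n. a k n * s ^ n)" for k s
    using bounded_linear.summable[OF bounded_linear_vec_nth[of k] summ[of s]] by (simp only: comp)
  have nth: "(\<Sum>n. (1 / fact n) *\<^sub>R ((\<lambda>x. s *\<^sub>R L x) ^^ n) v) $ k = (\<Sum>n. a k n * s ^ n)" for s k
    using bounded_linear.suminf[OF bounded_linear_vec_nth[of k] summ[of s]] by (simp only: comp)
  have der: "((\<lambda>s. \<Sum>n. a k n * s ^ n) has_real_derivative L v $ k) (at 0)" for k
    using termdiffs_strong_converges_everywhere[OF suma, of k 0]
    by (simp only: powser_zero) (simp add: diffs_def a_def)
  have "((\<lambda>s. \<Sum>k\<in>UNIV. (\<Sum>n. a k n * s ^ n) *\<^sub>R axis k (1::real)) has_vector_derivative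
          (\<Sum>k\<in>UNIV. L v $ k *\<^sub>R axis k 1)) (at 0)"
    by (intro has_vector_derivative_sum) (auto intro!: derivative_eq_intros der)
  then show ?thesis
    by (simp only: axis_expansion flip: nth)
qed

lemma linear_exp_series:
  fixes L :: "'a::euclidean_space \<Rightarrow> 'a"
  assumes "linear L"
  shows "linear (\<lambda>v. \<Sum>n. (1 / fact n) *\<^sub>R (L ^^ n) v)"
proof (rule linearI)
  note [simp] = linear_add[OF linear_funpow[OF assms]] linear_scale[OF linear_funpow[OF assms]]
  note summ = exp_series_summable[OF assms]
  show "(\<Sum>n. (1 / fact n) *\<^sub>R (L ^^ n) (u + v)) =
      (\<Sum>n. (1 / fact n) *\<^sub>R (L ^^ n) u) + (\<Sum>n. (1 / fact n) *\<^sub>R (L ^^ n) v)" for u v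
    by (simp add: scaleR_add_right suminf_add[OF summ summ])
  show "(\<Sum>n. (1 / fact n) *\<^sub>R (L ^^ n) (r *\<^sub>R v)) = r *\<^sub>R (\<Sum>n. (1 / fact n) *\<^sub>R (L ^^ n) v)" for r v
    using bounded_linear.suminf[OF bounded_linear_scaleR_right summ, of r v] by (simp add: mult.commute)
qed

section \<open>Differentials of transition maps\<close>

lemma smooth_on_has_derivative:
  assumes "smooth_on f S" "x \<in> S"
  shows "(f has_derivative frechet_derivative f (at x)) (at x)"
proof -
  have "Ck_on 1 f S" using assms(1) unfolding smooth_on_def by blast
  then have "f differentiable (at x)"
    using assms(2) unfolding differentiable_def by auto
  then show ?thesis by (simp add: frechet_derivative_works)
qed

lemma chart_inj_on:
  assumes "is_chart M c"
  shows "inj_on (snd c) (fst c)"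
proof -
  have "topspace (subtopology M (fst c)) = fst c"
    using assms unfolding is_chart_def by (auto dest: openin_subset)
  then show ?thesis
    using assms homeomorphic_imp_injective_map unfolding is_chart_def by metis
qed

lemma chart_inv_apply:
  assumes "is_chart M c" "p \<in> fst c"
  shows "chart_inv c (snd c p) = p"
  using assms chart_inj_on inv_into_f_f unfolding chart_inv_def by metis

lemma transition_apply:
  assumes "is_chart M c" "p \<in> fst c"
  shows "transition c d (snd c p) = snd d p"
  using chart_inv_apply[OF assms] by (simp add: transition_def)

lemma open_chart_image:
  assumes "is_chart M c" "openin M U" "U \<subseteq> fst c"
  shows "open (snd c ` U)"
proof -
  have "openin (subtopology M (fst c)) U"
    using assms by (auto simp: openin_subtopology)
  then have "openin (top_of_set (snd c ` fst c)) (snd c ` U)"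
    using assms(1) homeomorphic_imp_open_map unfolding is_chart_def open_map_def by metis
  then show ?thesis
    using assms(1) openin_open_trans unfolding is_chart_def by metis
qed

lemma charts_at_is_chart:
  assumes "oriented_manifold7 M \<A>" "c \<in> charts_at \<A> p"
  shows "is_chart M c" "p \<in> fst c" "c \<in> \<A>"
  using assms unfolding oriented_manifold7_def charts_at_def by auto

lemma transition_has_derivative:
  assumes "oriented_manifold7 M \<A>" "c \<in> charts_at \<A> p" "d \<in> charts_at \<A> p"
  shows "(transition c d has_derivative dtransition c d p) (at (snd c p))"
proof -
  have "smooth_on (transition c d) (snd c ` (fst c \<inter> fst d))"
    using assms unfolding oriented_manifold7_def charts_at_def by blast
  then show ?thesis
    unfolding dtransition_def using assms by (intro smooth_on_has_derivative) (auto simp: charts_at_def)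
qed

lemma linear_dtransition:
  assumes "oriented_manifold7 M \<A>" "c \<in> charts_at \<A> p" "d \<in> charts_at \<A> p"
  shows "linear (dtransition c d p)"
  using transition_has_derivative[OF assms] has_derivative_linear by blast

text \<open>The chain rule. On the overlap of the first two charts, which is open in coordinates, the
  transition maps themselves compose.\<close>

lemma dtransition_compose:
  assumes "oriented_manifold7 M \<A>" "c \<in> charts_at \<A> p" "d \<in> charts_at \<A> p" "e \<in> charts_at \<A> p"
  shows "dtransition d e p (dtransition c d p v) = dtransition c e p v"
proof -
  note c = charts_at_is_chart[OF assms(1,2)] and d = charts_at_is_chart[OF assms(1,3)]
  let ?U = "fst c \<inter> fst d"
  have "(transition d e has_derivative dtransition d e p) (at (transition c d (snd c p)))"
    using transition_has_derivative[OF assms(1,3,4)] transition_apply[OF c(1,2)] by metis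
  then have "(transition d e \<circ> transition c d has_derivative dtransition d e p \<circ> dtransition c d p) (at (snd c p))"
    using transition_has_derivative[OF assms(1-3)] diff_chain_at by blast
  moreover have "open (snd c ` ?U)"
    using c d by (intro open_chart_image[of M]) (auto simp: is_chart_def)
  moreover have "(transition d e \<circ> transition c d) x = transition c e x" if x: "x \<in> snd c ` ?U" for x
  proof -
    obtain q where q: "x = snd c q" "q \<in> ?U" using x by (rule imageE)
    then have "q \<in> fst c" "q \<in> fst d" by auto
    then show ?thesis
      by (simp add: q(1) transition_apply[OF c(1)] transition_apply[OF d(1)])
  qed
  ultimately have "(transition c e has_derivative dtransition d e p \<circ> dtransition c d p) (at (snd c p))"
    using c(2) d(2) by (elim has_derivative_transform_within_open) auto
  then show ?thesis
    using transition_has_derivative[OF assms(1,2,4)] has_derivative_unique by (metis comp_apply)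
qed

lemma dtransition_refl:
  assumes "oriented_manifold7 M \<A>" "c \<in> charts_at \<A> p"
  shows "dtransition c c p v = v"
proof -
  note c = charts_at_is_chart[OF assms]
  have "open (snd c ` fst c)" using c(1) by (simp add: is_chart_def)
  moreover have "x = transition c c x" if "x \<in> snd c ` fst c" for x
    using that transition_apply[OF c(1), of _ c] by auto
  ultimately have "(transition c c has_derivative (\<lambda>x. x)) (at (snd c p))"
    using c(2) by (intro has_derivative_transform_within_open[OF has_derivative_ident]) auto
  then show ?thesis
    using transition_has_derivative[OF assms(1,2,2)] has_derivative_unique by metis
qed

section \<open>Coordinates on a tangent space\<close>

definition fibre_endo :: "'m chart set \<Rightarrow> 'm \<Rightarrow> ('m tvec \<Rightarrow> 'm tvec) \<Rightarrow> bool" where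
  "fibre_endo \<A> p B \<longleftrightarrow> (\<forall>X\<in>tangent_space \<A> p. B X \<in> tangent_space \<A> p) \<and>
     (\<forall>X\<in>tangent_space \<A> p. \<forall>Y\<in>tangent_space \<A> p. \<forall>a b. B (lincomb a X b Y) = lincomb a (B X) b (B Y))"

lemma pointwise_endo_fibre:
  assumes "pointwise_endo \<A> E" "p \<in> points \<A>"
  shows "fibre_endo \<A> p (E p)"
  using assms unfolding pointwise_endo_def fibre_endo_def by blast

definition fibre_coords :: "'m chart set \<Rightarrow> 'm chart \<Rightarrow> 'm \<Rightarrow> ('m tvec \<Rightarrow> 'm tvec) \<Rightarrow> real^7 \<Rightarrow> real^7" where
  "fibre_coords \<A> c p B v = B (coord_vec \<A> c p v) c"

text \<open>A chart at a point identifies the tangent space with \<open>\<real>\<^sup>7\<close> by \<open>X \<mapsto> X c\<close> with inverse \<open>of_coords\<close>, and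
  the endomorphisms of the tangent space with linear maps \<open>coords\<close>. The facts below about a single
  tangent space are transported along this identification.\<close>

locale chart_point =
  fixes M :: "'m topology" and \<A> :: "'m chart set" and p :: 'm and c :: "'m chart"
  assumes manifold: "oriented_manifold7 M \<A>"
    and chart: "c \<in> charts_at \<A> p"
begin

abbreviation tangent :: "'m tvec set" where "tangent \<equiv> tangent_space \<A> p"
abbreviation of_coords :: "real^7 \<Rightarrow> 'm tvec" where "of_coords \<equiv> coord_vec \<A> c p"
abbreviation coords :: "('m tvec \<Rightarrow> 'm tvec) \<Rightarrow> real^7 \<Rightarrow> real^7" where "coords \<equiv> fibre_coords \<A> c p"

lemma point: "p \<in> points \<A>"
  using chart unfolding points_def charts_at_def by blast

lemma coord_vec_in_tangent: "of_coords v \<in> tangent"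
  using chart by (simp add: tangent_space_def coord_vec_def dtransition_compose[OF manifold])

lemma coord_vec_self: "of_coords v c = v"
  using chart by (simp add: coord_vec_def dtransition_refl[OF manifold])

lemma tangentD:
  assumes "X \<in> tangent"
  shows "d \<notin> charts_at \<A> p \<Longrightarrow> X d = 0"
    and "d \<in> charts_at \<A> p \<Longrightarrow> e \<in> charts_at \<A> p \<Longrightarrow> dtransition d e p (X d) = X e"
proof -
  note X = CollectD[OF assms[unfolded tangent_space_def]]
  show "X d = 0" if "d \<notin> charts_at \<A> p"
    by (rule conjunct1[OF X, THEN spec, THEN mp, OF that])
  show "dtransition d e p (X d) = X e" if "d \<in> charts_at \<A> p" "e \<in> charts_at \<A> p"
    by (rule conjunct2[OF X, THEN bspec, THEN bspec, OF that, symmetric])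
qed

lemma coord_vec_coord:
  assumes "X \<in> tangent"
  shows "of_coords (X c) = X"
proof
  show "of_coords (X c) d = X d" for d
  proof (cases "d \<in> charts_at \<A> p")
    case True
    then show ?thesis by (simp add: coord_vec_def tangentD(2)[OF assms chart])
  next
    case False
    then show ?thesis by (simp add: coord_vec_def tangentD(1)[OF assms])
  qed
qed

lemma tangent_eqI:
  assumes "X \<in> tangent" "Y \<in> tangent" "X c = Y c"
  shows "X = Y"
proof -
  have "X = of_coords (X c)" by (rule coord_vec_coord[OF assms(1), symmetric])
  also have "\<dots> = Y" by (simp only: assms(3) coord_vec_coord[OF assms(2)])
  finally show ?thesis .
qed

lemma lincomb_in_tangent:
  assumes "X \<in> tangent" "Y \<in> tangent"
  shows "lincomb a X b Y \<in> tangent"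
  unfolding tangent_space_def
proof (intro CollectI conjI allI impI ballI)
  show "lincomb a X b Y d = 0" if "d \<notin> charts_at \<A> p" for d
    using that assms[THEN tangentD(1)] by (simp add: lincomb_def)
  fix d e assume de: "d \<in> charts_at \<A> p" "e \<in> charts_at \<A> p"
  note lin = linear_dtransition[OF manifold de]
  show "lincomb a X b Y e = dtransition d e p (lincomb a X b Y d)"
    using assms[THEN tangentD(2)[OF _ de]] by (simp add: lincomb_def linear_add[OF lin] linear_scale[OF lin])
qed

lemma coord_vec_lincomb: "of_coords (a *\<^sub>R u + b *\<^sub>R v) = lincomb a (of_coords u) b (of_coords v)"
proof (rule tangent_eqI)
  show "of_coords (a *\<^sub>R u + b *\<^sub>R v) c = lincomb a (of_coords u) b (of_coords v) c"
    by (simp add: lincomb_def coord_vec_self)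
qed (simp_all add: lincomb_in_tangent coord_vec_in_tangent)

lemma coords_apply: "X \<in> tangent \<Longrightarrow> coords B (X c) = B X c"
  by (simp add: fibre_coords_def coord_vec_coord)

lemma linear_coords:
  assumes "fibre_endo \<A> p B"
  shows "linear (coords B)"
proof -
  have *: "coords B (a *\<^sub>R u + b *\<^sub>R v) = a *\<^sub>R coords B u + b *\<^sub>R coords B v" for a b u v
    using assms coord_vec_in_tangent
    by (simp add: fibre_coords_def coord_vec_lincomb fibre_endo_def) (simp add: lincomb_def)
  show ?thesis
    using *[of 1 _ 1] *[of _ _ 0] by (intro linearI) simp_all
qed

lemma bij_coords_iff:
  assumes "fibre_endo \<A> p B"
  shows "bij (coords B) \<longleftrightarrow> bij_betw B tangent tangent"
proof -
  have v: "bij_betw of_coords UNIV tangent"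
    by (rule bij_betw_byWitness[where f' = "\<lambda>X. X c"])
      (auto simp: coord_vec_self coord_vec_coord coord_vec_in_tangent)
  have c: "bij_betw (\<lambda>X. X c) tangent UNIV"
    by (rule bij_betw_byWitness[where f' = of_coords])
      (auto simp: coord_vec_self coord_vec_coord coord_vec_in_tangent)
  have into: "B ` tangent \<subseteq> tangent" using assms by (auto simp: fibre_endo_def)
  have "bij_betw B tangent tangent \<longleftrightarrow> bij_betw (B \<circ> of_coords) UNIV tangent"
    by (rule bij_betw_comp_iff[OF v])
  also have "\<dots> \<longleftrightarrow> bij_betw ((\<lambda>X. X c) \<circ> (B \<circ> of_coords)) UNIV UNIV"
    using into coord_vec_in_tangent by (intro bij_betw_comp_iff2[OF c]) auto
  also have "(\<lambda>X. X c) \<circ> (B \<circ> of_coords) = coords B"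
    by (auto simp: fibre_coords_def)
  finally show ?thesis by simp
qed

lemma inv_fibre_endo:
  assumes "fibre_endo \<A> p B" "bij_betw B tangent tangent" "X \<in> tangent"
  shows "inv_into tangent B X = of_coords (inv (coords B) (X c))"
proof -
  let ?Y = "of_coords (inv (coords B) (X c))"
  have "surj (coords B)"
    using assms(1,2) by (simp add: bij_coords_iff[symmetric] bij_is_surj)
  then have "B ?Y c = X c"
    using surj_f_inv_f[of "coords B" "X c"] by (simp add: fibre_coords_def)
  moreover have "B ?Y \<in> tangent"
    using assms(1) by (simp add: fibre_endo_def coord_vec_in_tangent)
  ultimately have "B ?Y = X"
    using assms(3) tangent_eqI by simp
  then show ?thesis
    using bij_betw_inv_into_left[OF assms(2) coord_vec_in_tangent, of "inv (coords B) (X c)"] by simp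
qed

lemma multilinear_coords:
  assumes "tensor_field \<A> k \<omega>"
  shows "multilinear k (\<lambda>vs. \<omega> p (map of_coords vs))"
  unfolding multilinear_def
proof (intro allI impI)
  fix vs :: "(real^7) list" and i assume vs: "length vs = k \<and> i < k"
  have "map of_coords vs \<in> tlists \<A> k p"
    using vs coord_vec_in_tangent by (auto simp: tlists_def)
  then have *: "\<omega> p ((map of_coords vs)[i := lincomb a (of_coords u) b (of_coords v)])
      = a * \<omega> p ((map of_coords vs)[i := of_coords u]) + b * \<omega> p ((map of_coords vs)[i := of_coords v])" for a b u v
    using assms vs point coord_vec_in_tangent unfolding tensor_field_def by blast
  show "linear (\<lambda>v. \<omega> p (map of_coords (vs[i := v])))"
    using *[of 1 _ 1] *[of _ _ 0] coord_vec_lincomb[of 1 _ 1] coord_vec_lincomb[of _ _ 0]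
    by (intro linearI) (simp_all add: map_update)
qed

section \<open>The derivative of a moving pullback\<close>

text \<open>The common source of both evaluations of derivatives of \<open>\<psi>\<close>. Bijectivity is assumed at \<open>t\<close> only: it
  persists nearby, as the determinant in coordinates is continuous. In coordinates this is the
  derivative of the inverse inserted into the product rule.\<close>

lemma gauge_inv_has_derivative:
  assumes \<omega>: "tensor_field \<A> k \<omega>" and Xs: "Xs \<in> tlists \<A> k p"
    and endo: "eventually (\<lambda>s. fibre_endo \<A> p (B s)) (nhds t)"
    and bij: "bij_betw (B t) tangent tangent"
    and B': "\<And>X. X \<in> tangent \<Longrightarrow> B' X \<in> tangent"
    and der: "\<And>X. X \<in> tangent \<Longrightarrow> ((\<lambda>s. B s X c) has_vector_derivative B' X c) (at t)"
  defines "R \<equiv> inv_into tangent (B t)"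
  shows "((\<lambda>s. \<omega> p (map (inv_into tangent (B s)) Xs)) has_real_derivative
      - (\<Sum>i<k. \<omega> p ((map R Xs)[i := R (B' (R (Xs ! i)))]))) (at t)"
proof -
  let ?F = "\<lambda>vs. \<omega> p (map of_coords vs)"
  let ?L = "\<lambda>s. coords (B s)"
  have len: "length Xs = k" and sub: "set Xs \<subseteq> tangent" using Xs by (auto simp: tlists_def)
  have endo_t: "fibre_endo \<A> p (B t)" using endo eventually_nhds_x_imp_x by blast
  have lin: "eventually (\<lambda>s. linear (?L s)) (nhds t)"
    using endo by eventually_elim (rule linear_coords)
  have bijL: "bij (?L t)" using bij bij_coords_iff[OF endo_t] by simp
  have derL: "((\<lambda>s. ?L s v) has_vector_derivative coords B' v) (at t)" for v
    using der[OF coord_vec_in_tangent] unfolding fibre_coords_def .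
  note inv = inverse_family_has_derivative[where L = ?L, OF lin bijL derL]
  have rep: "map (inv_into tangent (B s)) Xs = map of_coords (map (\<lambda>X. inv (?L s) (X c)) Xs)"
    if "fibre_endo \<A> p (B s)" "bij (?L s)" for s
    using that sub by (auto simp: bij_coords_iff inv_fibre_endo)
  have R: "R X \<in> tangent" "R X c = inv (?L t) (X c)" if "X \<in> tangent" for X
    using inv_fibre_endo[OF endo_t bij that] by (auto simp: R_def coord_vec_in_tangent coord_vec_self)
  have "((\<lambda>s. ?F (map (\<lambda>X. inv (?L s) (X c)) Xs)) has_real_derivative
      (\<Sum>i<length Xs. ?F ((map (\<lambda>X. inv (?L t) (X c)) Xs)[i :=
         - inv (?L t) (coords B' (inv (?L t) ((Xs ! i) c)))]))) (at t)"
    using multilinear_coords[OF \<omega>] len by (intro multilinear_has_derivative inv(2)) simp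
  moreover have "?F ((map (\<lambda>X. inv (?L t) (X c)) Xs)[i := - inv (?L t) (coords B' (inv (?L t) ((Xs ! i) c)))])
      = - \<omega> p ((map R Xs)[i := R (B' (R (Xs ! i)))])" if i: "i < k" for i
  proof -
    let ?vs = "map (\<lambda>X. inv (?L t) (X c)) Xs"
    have Xi: "Xs ! i \<in> tangent" using i len sub by auto
    have "linear (\<lambda>v. ?F (?vs[i := v]))"
      using multilinear_coords[OF \<omega>] i len unfolding multilinear_def by simp
    then have "?F (?vs[i := - w]) = - ?F (?vs[i := w])" for w
      by (rule linear_neg)
    moreover have "inv (?L t) (coords B' (inv (?L t) ((Xs ! i) c))) = R (B' (R (Xs ! i))) c"
      using R Xi B' coords_apply by metis
    moreover have "map of_coords ?vs = map R Xs"
      using rep[OF endo_t bijL] by (simp add: R_def)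
    moreover have "of_coords (R (B' (R (Xs ! i))) c) = R (B' (R (Xs ! i)))"
      using R(1) Xi B' coord_vec_coord by simp
    ultimately show ?thesis
      by (simp only: map_update)
  qed
  ultimately have "((\<lambda>s. ?F (map (\<lambda>X. inv (?L s) (X c)) Xs)) has_real_derivative
      - (\<Sum>i<k. \<omega> p ((map R Xs)[i := R (B' (R (Xs ! i)))]))) (at t)"
    by (simp add: len sum_negf del: map_map)
  moreover have ev: "eventually (\<lambda>s. \<omega> p (map (inv_into tangent (B s)) Xs)
      = ?F (map (\<lambda>X. inv (?L s) (X c)) Xs)) (nhds t)"
    using endo inv(1) by eventually_elim (simp only: rep)
  ultimately show ?thesis
    using DERIV_cong_ev[OF refl ev refl] by simp
qed

section \<open>The derivation action as derivative along exponentials\<close>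

lemma funpow_coords:
  assumes "fibre_endo \<A> p B" "X \<in> tangent"
  shows "(B ^^ n) X \<in> tangent" and "(B ^^ n) X c = (coords B ^^ n) (X c)"
proof -
  show *: "(B ^^ n) X \<in> tangent" for n
    by (induction n) (use assms in \<open>auto simp: fibre_endo_def\<close>)
  show "(B ^^ n) X c = (coords B ^^ n) (X c)"
    by (induction n) (simp_all add: * flip: coords_apply)
qed

lemma endo_exp_coords:
  assumes "fibre_endo \<A> p (E p)" "X \<in> tangent"
  shows "endo_exp E p X c = (\<Sum>n. (1 / fact n) *\<^sub>R (coords (E p) ^^ n) (X c))"
  using funpow_coords(2)[OF assms] by (simp add: endo_exp_def)

text \<open>The exponential is defined by a separate series in each chart. The series are compatible
  because the differentials of the transition maps are linear, hence commute with infinite sums.\<close>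

lemma endo_exp_in_tangent:
  assumes E: "fibre_endo \<A> p (E p)" and X: "X \<in> tangent"
  shows "endo_exp E p X \<in> tangent"
  unfolding tangent_space_def
proof (intro CollectI conjI allI impI ballI)
  fix d assume "d \<notin> charts_at \<A> p"
  then have "(E p ^^ n) X d = 0" for n
    using tangentD(1)[OF funpow_coords(1)[OF E X]] by simp
  then show "endo_exp E p X d = 0" by (simp add: endo_exp_def)
next
  fix d e assume de: "d \<in> charts_at \<A> p" "e \<in> charts_at \<A> p"
  interpret d: chart_point M \<A> p d by unfold_locales (use manifold de in auto)
  have "summable (\<lambda>n. (1 / fact n) *\<^sub>R (E p ^^ n) X d)"
    using exp_series_summable[OF d.linear_coords[OF E]] by (simp add: d.funpow_coords(2)[OF E X])
  moreover have lin: "linear (dtransition d e p)" using linear_dtransition[OF manifold de] .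
  moreover have "(E p ^^ n) X e = dtransition d e p ((E p ^^ n) X d)" for n
    using tangentD(2)[OF funpow_coords(1)[OF E X] de] by simp
  ultimately show "endo_exp E p X e = dtransition d e p (endo_exp E p X d)"
    using bounded_linear.suminf[OF linear_conv_bounded_linear[THEN iffD1, OF lin]]
    by (simp add: endo_exp_def linear_scale[OF lin])
qed

lemma fibre_endo_exp:
  assumes E: "fibre_endo \<A> p (E p)"
  shows "fibre_endo \<A> p (endo_exp E p)"
proof -
  have "endo_exp E p (lincomb a X b Y) = lincomb a (endo_exp E p X) b (endo_exp E p Y)"
    if XY: "X \<in> tangent" "Y \<in> tangent" for a b X Y
  proof (rule tangent_eqI)
    note lin = linear_exp_series[OF linear_coords[OF E]]
    show "endo_exp E p (lincomb a X b Y) c = lincomb a (endo_exp E p X) b (endo_exp E p Y) c"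
      using XY linear_add[OF lin] linear_scale[OF lin]
      by (simp add: endo_exp_coords[where E = E, OF E] lincomb_in_tangent)
        (simp add: lincomb_def endo_exp_coords[where E = E, OF E])
  qed (simp_all add: XY E endo_exp_in_tangent lincomb_in_tangent)
  then show ?thesis
    using endo_exp_in_tangent[where E = E, OF E] by (simp add: fibre_endo_def)
qed

lemma fibre_endo_scale:
  assumes "fibre_endo \<A> p (E p)"
  shows "fibre_endo \<A> p (endo_scale s E p)"
proof -
  have "endo_scale s E p X = lincomb s (E p X) 0 (E p X)" for X
    by (simp add: endo_scale_def lincomb_def)
  then show ?thesis
    using assms lincomb_in_tangent by (auto simp: fibre_endo_def) (auto simp: lincomb_def algebra_simps)
qed

text \<open>The family \<open>exp (s E)\<close> is the identity with derivative \<open>E\<close> at \<open>s = 0\<close>, so the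
  derivative of a moving pullback applies with trivial inverse.\<close>

lemma D_op_eq:
  assumes \<omega>: "tensor_field \<A> k \<omega>" and Xs: "Xs \<in> tlists \<A> k p" and E: "fibre_endo \<A> p (E p)"
  shows "D_op \<A> \<omega> E p Xs = - (\<Sum>i<k. \<omega> p (Xs[i := E p (Xs ! i)]))"
proof -
  define B where "B s = endo_exp (endo_scale s E) p" for s
  note Es = fibre_endo_scale[where E = E, OF E]
  have len: "length Xs = k" and sub: "set Xs \<subseteq> tangent" using Xs by (auto simp: tlists_def)
  have coords_s: "coords (endo_scale s E p) = (\<lambda>v. s *\<^sub>R coords (E p) v)" for s
    by (simp add: fun_eq_iff fibre_coords_def endo_scale_def)
  have B: "B s X c = (\<Sum>n. (1 / fact n) *\<^sub>R ((\<lambda>v. s *\<^sub>R coords (E p) v) ^^ n) (X c))" if "X \<in> tangent" for s X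
    using endo_exp_coords[where E = "endo_scale s E", OF Es that] by (simp add: B_def coords_s)
  have der: "((\<lambda>s. B s X c) has_vector_derivative E p X c) (at 0)" if "X \<in> tangent" for X
    using exp_series_has_derivative_at_0[OF linear_coords[OF E], of "X c"] B[OF that] coords_apply[OF that]
    by simp
  have B0X: "B 0 X = X" if "X \<in> tangent" for X
  proof (rule tangent_eqI)
    have "((\<lambda>v. 0) ^^ n) (X c) = (if n = 0 then X c else 0)" for n by (cases n) simp_all
    then show "B 0 X c = X c"
      using sums_unique[OF sums_single[of 0 "\<lambda>_. X c"]]
      by (simp add: B[OF that] if_distrib[of "\<lambda>x. _ *\<^sub>R x"] cong: if_cong)
    show "B 0 X \<in> tangent"
      unfolding B_def by (intro endo_exp_in_tangent Es that)
  qed (rule that)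
  then have B0: "bij_betw (B 0) tangent tangent"
    by (simp add: bij_betw_cong[where g = id])
  have R: "inv_into tangent (B 0) X = X" if "X \<in> tangent" for X
    using bij_betw_inv_into_left[OF B0 that] B0X[OF that] by simp
  have mapR: "map (inv_into tangent (B 0)) Xs = Xs"
    using sub R by (intro map_idI) auto
  have "eventually (\<lambda>s. fibre_endo \<A> p (B s)) (nhds 0)"
    unfolding B_def by (intro always_eventually allI fibre_endo_exp Es)
  moreover have "E p X \<in> tangent" if "X \<in> tangent" for X using that E by (simp add: fibre_endo_def)
  ultimately have "((\<lambda>s. \<omega> p (map (inv_into tangent (B s)) Xs)) has_real_derivative
      - (\<Sum>i<k. \<omega> p ((map (inv_into tangent (B 0)) Xs)[i :=
          inv_into tangent (B 0) (E p (inv_into tangent (B 0) (Xs ! i)))]))) (at 0)"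
    using B0 der by (intro gauge_inv_has_derivative \<omega> Xs)
  moreover have "inv_into tangent (B 0) (E p (inv_into tangent (B 0) (Xs ! i))) = E p (Xs ! i)" if "i < k" for i
    using that len sub E by (simp add: R fibre_endo_def subset_iff)
  ultimately have "((\<lambda>s. \<omega> p (map (inv_into tangent (B s)) Xs)) has_real_derivative
      - (\<Sum>i<k. \<omega> p (Xs[i := E p (Xs ! i)]))) (at 0)"
    by (simp add: mapR)
  then show ?thesis
    unfolding D_op_def gauge_act_def gauge_inv_def B_def by (rule DERIV_imp_deriv)
qed

section \<open>Time derivative of a gauge-deformed form\<close>

lemma gauge_family_fibre:
  assumes "gauge_family \<A> I A" "s \<in> I"
  shows "fibre_endo \<A> p (A s p)" and "bij_betw (A s p) tangent tangent"
proof -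
  have "pointwise_endo \<A> (A s)" and "bij_betw (A s p) tangent tangent"
    using assms point unfolding gauge_family_def by blast+
  then show "fibre_endo \<A> p (A s p)" and "bij_betw (A s p) tangent tangent"
    by (simp_all add: pointwise_endo_fibre point)
qed

lemma gauge_family_has_derivative:
  assumes A: "gauge_family \<A> I A" and t: "t \<in> I" and X: "X \<in> tangent"
  shows "((\<lambda>s. A s p X c) has_vector_derivative endo_dot A t p X c) (at t)"
proof -
  note c = charts_at_is_chart[OF manifold chart]
  let ?f = "\<lambda>(s, x). endo_rep \<A> c (A s) (X c) x"
  have "smooth_on ?f (I \<times> snd c ` fst c)"
    using A c(3) unfolding gauge_family_def by blast
  then have "(?f has_derivative frechet_derivative ?f (at (t, snd c p))) (at (t, snd c p))"
    using t c(2) by (intro smooth_on_has_derivative) auto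
  moreover have "((\<lambda>s. (s, snd c p)) has_vector_derivative (1, 0)) (at t)"
    by (intro has_vector_derivative_Pair derivative_intros)
  ultimately have "(?f \<circ> (\<lambda>s. (s, snd c p)) has_vector_derivative
      frechet_derivative ?f (at (t, snd c p)) (1, 0)) (at t)"
    by (intro vector_derivative_diff_chain_within) (auto intro: has_derivative_at_withinI)
  moreover have "?f \<circ> (\<lambda>s. (s, snd c p)) = (\<lambda>s. A s p X c)"
    by (simp add: fun_eq_iff endo_rep_def chart_inv_apply[OF c(1,2)] coord_vec_coord[OF X])
  ultimately have "((\<lambda>s. A s p X c) has_vector_derivative
      frechet_derivative ?f (at (t, snd c p)) (1, 0)) (at t)"
    by simp
  then show ?thesis
    unfolding endo_dot_def by (simp add: vector_derivative_at)
qed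

text \<open>Since the time derivative is taken in each chart separately, compatibility with changes of
  charts and linearity have to be inherited from the nearby times in \<open>I\<close>.\<close>

lemma fibre_endo_dot:
  assumes A: "gauge_family \<A> I A" and I: "open I" and t: "t \<in> I"
  shows "fibre_endo \<A> p (endo_dot A t p)"
proof -
  have transfer: "vector_derivative f (at t) = D"
    if "(g has_vector_derivative D) (at t)" "\<And>s. s \<in> I \<Longrightarrow> g s = f s" for f g :: "real \<Rightarrow> real^7" and D
    using has_vector_derivative_transform_within_open[OF that(1) I t that(2)] by (rule vector_derivative_at)
  have AX: "A s p X \<in> tangent" if "s \<in> I" "X \<in> tangent" for s X
    using gauge_family_fibre(1)[OF A that(1)] that(2) by (simp add: fibre_endo_def)
  have in_T: "endo_dot A t p X \<in> tangent" if X: "X \<in> tangent" for X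
    unfolding tangent_space_def
  proof (intro CollectI conjI allI impI ballI)
    fix d assume d: "d \<notin> charts_at \<A> p"
    show "endo_dot A t p X d = 0"
      unfolding endo_dot_def
      by (rule transfer[OF has_vector_derivative_const[of 0]]) (simp add: tangentD(1)[OF AX[OF _ X] d])
  next
    fix d e assume de: "d \<in> charts_at \<A> p" "e \<in> charts_at \<A> p"
    interpret d: chart_point M \<A> p d by unfold_locales (use manifold de in auto)
    have "bounded_linear (dtransition d e p)"
      using linear_dtransition[OF manifold de] by (simp add: linear_conv_bounded_linear)
    from bounded_linear.has_vector_derivative[OF this d.gauge_family_has_derivative[OF A t X]]
    show "endo_dot A t p X e = dtransition d e p (endo_dot A t p X d)"
      unfolding endo_dot_def[of A t p X, THEN fun_cong, of e]
      by (rule transfer) (rule tangentD(2)[OF AX[OF _ X] de])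
  qed
  have "endo_dot A t p (lincomb a X b Y) = lincomb a (endo_dot A t p X) b (endo_dot A t p Y)"
    if X: "X \<in> tangent" and Y: "Y \<in> tangent" for a b X Y
  proof (rule tangent_eqI)
    have "((\<lambda>s. a *\<^sub>R A s p X c + b *\<^sub>R A s p Y c) has_vector_derivative
        a *\<^sub>R endo_dot A t p X c + b *\<^sub>R endo_dot A t p Y c) (at t)"
      by (intro has_vector_derivative_add bounded_linear.has_vector_derivative[OF bounded_linear_scaleR_right]
          gauge_family_has_derivative[OF A t] X Y)
    then have "vector_derivative (\<lambda>s. A s p (lincomb a X b Y) c) (at t)
        = a *\<^sub>R endo_dot A t p X c + b *\<^sub>R endo_dot A t p Y c"
    proof (rule transfer)
      fix s assume "s \<in> I"
      from gauge_family_fibre(1)[OF A this] X Y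
      have "A s p (lincomb a X b Y) = lincomb a (A s p X) b (A s p Y)" by (simp add: fibre_endo_def)
      then show "a *\<^sub>R A s p X c + b *\<^sub>R A s p Y c = A s p (lincomb a X b Y) c"
        by (simp add: lincomb_def)
    qed
    then show "endo_dot A t p (lincomb a X b Y) c = lincomb a (endo_dot A t p X) b (endo_dot A t p Y) c"
      by (simp add: endo_dot_def lincomb_def)
  qed (intro in_T lincomb_in_tangent X Y)+
  with in_T show ?thesis by (simp add: fibre_endo_def)
qed

lemma fibre_endo_inv:
  assumes B: "fibre_endo \<A> p B" and bij: "bij_betw B tangent tangent"
  shows "fibre_endo \<A> p (inv_into tangent B)"
proof -
  let ?R = "inv_into tangent B"
  have R: "?R X \<in> tangent" "B (?R X) = X" if "X \<in> tangent" for X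
    using that bij by (simp_all add: bij_betw_def inv_into_into f_inv_into_f)
  have "?R (lincomb a X b Y) = lincomb a (?R X) b (?R Y)" if "X \<in> tangent" "Y \<in> tangent" for a b X Y
  proof -
    have "B (lincomb a (?R X) b (?R Y)) = lincomb a X b Y"
      using B R that by (simp add: fibre_endo_def)
    then show ?thesis
      using bij_betw_inv_into_left[OF bij lincomb_in_tangent[OF R(1) R(1)]] that by metis
  qed
  with R show ?thesis by (simp add: fibre_endo_def)
qed

text \<open>Writing \<open>R\<close> for the inverse of \<open>A\<^sub>t\<close>, the slot \<open>i\<close> of \<open>A\<^sub>s \<omega>\<close> contributes \<open>R (A' (R X\<^sub>i))\<close> in place of
  \<open>R X\<^sub>i\<close>. That is the image under \<open>R\<close> of \<open>(A' R) X\<^sub>i\<close>, hence the term of the derivation action of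
  \<open>A' R\<close> on \<open>A\<^sub>t \<omega>\<close>.\<close>

lemma gauge_act_has_derivative:
  assumes A: "gauge_family \<A> I A" and I: "open I" and t: "t \<in> I"
    and \<omega>: "tensor_field \<A> k \<omega>" and \<omega>t: "tensor_field \<A> k (gauge_act \<A> (A t) \<omega>)"
    and Xs: "Xs \<in> tlists \<A> k p"
  shows "((\<lambda>s. gauge_act \<A> (A s) \<omega> p Xs) has_real_derivative
      D_op \<A> (gauge_act \<A> (A t) \<omega>) (endo_compose (endo_dot A t) (gauge_inv \<A> (A t))) p Xs) (at t)"
proof -
  let ?R = "inv_into tangent (A t p)"
  let ?E = "endo_compose (endo_dot A t) (gauge_inv \<A> (A t))"
  have E: "?E p = endo_dot A t p \<circ> ?R"
    by (simp add: endo_compose_def gauge_inv_def)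
  note dot = fibre_endo_dot[OF A I t]
  have "fibre_endo \<A> p (?E p)"
    using fibre_endo_inv[OF gauge_family_fibre[OF A t]] dot unfolding E by (simp add: fibre_endo_def)
  then have "D_op \<A> (gauge_act \<A> (A t) \<omega>) ?E p Xs
      = - (\<Sum>i<k. gauge_act \<A> (A t) \<omega> p (Xs[i := ?E p (Xs ! i)]))"
    by (rule D_op_eq[OF \<omega>t Xs])
  also have "\<dots> = - (\<Sum>i<k. \<omega> p ((map ?R Xs)[i := ?R (endo_dot A t p (?R (Xs ! i)))]))"
    by (simp add: E gauge_act_def gauge_inv_def map_update)
  finally have D: "D_op \<A> (gauge_act \<A> (A t) \<omega>) ?E p Xs = \<dots>" .
  have "eventually (\<lambda>s. s \<in> I) (nhds t)"
    using I t by (rule eventually_nhds_in_open)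
  then have ev: "eventually (\<lambda>s. fibre_endo \<A> p (A s p)) (nhds t)"
    by eventually_elim (rule gauge_family_fibre(1)[OF A])
  show ?thesis
    unfolding D gauge_act_def gauge_inv_def
    using dot
    by (intro gauge_inv_has_derivative[OF \<omega> Xs ev gauge_family_fibre(2)[OF A t]]
        gauge_family_has_derivative[OF A t]) (simp_all add: fibre_endo_def)
qed

section \<open>Exterior derivative and torsion\<close>

text \<open>Polarisation: expand the vanishing value with the sum of both vectors in both slots.\<close>

lemma diff_form_swap:
  assumes \<omega>: "diff_form \<A> k \<omega>" and Xs: "Xs \<in> tlists \<A> k p" and ij: "i < k" "j < k" "i \<noteq> j"
  shows "\<omega> p (Xs[i := Xs ! j, j := Xs ! i]) = - \<omega> p Xs"
proof -
  let ?X = "Xs ! i" and ?Y = "Xs ! j"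
  let ?S = "lincomb 1 ?X 1 ?Y"
  have len: "length Xs = k" using Xs by (simp add: tlists_def)
  have XY: "?X \<in> tangent" "?Y \<in> tangent" using Xs ij by (auto simp: tlists_def)
  have lists: "Xs[a := U, b := V] \<in> tlists \<A> k p" if "U \<in> tangent" "V \<in> tangent" for U V a b
    using Xs that set_update_subset_insert[of "Xs[a := U]" b V] set_update_subset_insert[of Xs a U]
    by (auto simp: tlists_def)
  have zero: "\<omega> p (Xs[i := U, j := U]) = 0" if "U \<in> tangent" for U
  proof -
    have "\<not> distinct (Xs[i := U, j := U])"
      using ij len by (auto simp: distinct_conv_nth nth_list_update)
    then show ?thesis
      using \<omega> lists[OF that that] point unfolding diff_form_def by blast
  qed
  have lin: "\<omega> p (Ys[a := ?S]) = \<omega> p (Ys[a := ?X]) + \<omega> p (Ys[a := ?Y])"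
    if "Ys \<in> tlists \<A> k p" "a < k" for Ys a
  proof -
    have "\<forall>a b. \<omega> p (Ys[i := lincomb a X b Y]) = a * \<omega> p (Ys[i := X]) + b * \<omega> p (Ys[i := Y])"
      if "i < k" "X \<in> tangent" "Y \<in> tangent" for i X Y
      using \<omega> point \<open>Ys \<in> tlists \<A> k p\<close> that unfolding diff_form_def tensor_field_def by blast
    from this[OF that(2) XY, rule_format, of 1 1] show ?thesis by simp
  qed
  have S: "?S \<in> tangent" using XY by (rule lincomb_in_tangent)
  have swap: "Xs[i := U, j := V] = Xs[j := V, i := U]" for U V
    using ij(3) by (rule list_update_swap)
  have "0 = \<omega> p (Xs[i := ?S, j := ?S])" using zero[OF S] by simp
  also have "\<dots> = \<omega> p (Xs[i := ?S, j := ?X]) + \<omega> p (Xs[i := ?S, j := ?Y])"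
    using lin[OF lists[OF S S, of i j] ij(2)] by (simp only: list_update_overwrite)
  also have "\<dots> = \<omega> p (Xs[i := ?Y, j := ?X]) + \<omega> p (Xs[i := ?X, j := ?Y])"
    using lin[OF lists[OF XY(1) XY(1), of j j] ij(1)] lin[OF lists[OF XY(2) XY(2), of j j] ij(1)]
      zero[OF XY(1)] zero[OF XY(2)]
    by (simp only: swap list_update_overwrite add_0_left add_0_right)
  also have "Xs[i := ?X, j := ?Y] = Xs" by simp
  finally show ?thesis by simp
qed

end

text \<open>The exterior derivative alternates the coordinate derivatives of the components. They differ from
  the components of \<open>\<nabla>\<phi>\<close> by terms with \<open>\<Gamma> (X\<^sub>i, X\<^sub>j)\<close> in one slot. Each unordered pair \<open>i, j\<close> occurs twice,
  with opposite signs after alternation, so these terms cancel by the symmetry of \<open>\<Gamma>\<close>.\<close>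

lemma ext_deriv_eq_cov_deriv:
  fixes \<A> :: "'m chart set"
  assumes M: "oriented_manifold7 M \<A>" and p: "p \<in> points \<A>"
    and sym: "\<And>c u v. c \<in> charts_at \<A> p \<Longrightarrow> \<Gamma> c p u v = \<Gamma> c p v u"
    and \<phi>: "diff_form \<A> 3 \<phi>"
    and Xs: "Xs \<in> tlists \<A> 4 p"
  shows "ext_deriv \<A> \<phi> p Xs
    = (\<Sum>i<4. (-1) ^ i * cov_deriv \<A> \<Gamma> \<phi> p (Xs ! i) (take i Xs @ drop (Suc i) Xs))"
proof -
  (* Exterior and covariant derivative select the same chart, so their coordinate expressions
     can be compared term by term. *)
  define c where "c = chart_at \<A> p"
  have "\<exists>d. d \<in> charts_at \<A> p"
    using p by (auto simp: points_def charts_at_def)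
  then have "c \<in> charts_at \<A> p"
    unfolding c_def chart_at_def by (rule someI_ex)
  then interpret chart_point M \<A> p c using M by unfold_locales
  define G where "G X Y = of_coords (\<Gamma> c p (X c) (Y c))" for X Y :: "'m tvec"
  have G: "G X Y = G Y X" for X Y unfolding G_def using sym[OF chart] by simp
  have GT: "G X Y \<in> tangent" for X Y unfolding G_def by (rule coord_vec_in_tangent)
  obtain X0 X1 X2 X3 where X: "Xs = [X0, X1, X2, X3]"
    using Xs by (auto simp: tlists_def length_Suc_conv numeral_eq_Suc)
  have T: "X0 \<in> tangent" "X1 \<in> tangent" "X2 \<in> tangent" "X3 \<in> tangent"
    using Xs by (simp_all add: X tlists_def)
  have swap01: "\<phi> p [V, U, W] = - \<phi> p [U, V, W]" and swap12: "\<phi> p [U, W, V] = - \<phi> p [U, V, W]"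
    if "U \<in> tangent" "V \<in> tangent" "W \<in> tangent" for U V W
    using diff_form_swap[OF \<phi>, of "[U, V, W]" 0 1] diff_form_swap[OF \<phi>, of "[U, V, W]" 1 2] that
    by (simp_all add: tlists_def numeral_eq_Suc)
  let ?D = "\<lambda>X Ys. frechet_derivative (local_rep \<A> c \<phi> (map (\<lambda>Y. Y c) Ys)) (at (snd c p)) (X c)"
  have cov: "?D X [U, V, W] = cov_deriv \<A> \<Gamma> \<phi> p X [U, V, W]
      + (\<phi> p [G X U, V, W] + \<phi> p [U, G X V, W] + \<phi> p [U, V, G X W])" for X U V W
    by (simp add: cov_deriv_def c_def[symmetric] G_def numeral_eq_Suc)
  have ext: "ext_deriv \<A> \<phi> p Xs = ?D X0 [X1, X2, X3] - ?D X1 [X0, X2, X3] + ?D X2 [X0, X1, X3] - ?D X3 [X0, X1, X2]"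
    by (simp add: ext_deriv_def c_def[symmetric] X numeral_eq_Suc)
  have alt: "(\<Sum>i<4. (-1) ^ i * cov_deriv \<A> \<Gamma> \<phi> p (Xs ! i) (take i Xs @ drop (Suc i) Xs))
      = cov_deriv \<A> \<Gamma> \<phi> p X0 [X1, X2, X3] - cov_deriv \<A> \<Gamma> \<phi> p X1 [X0, X2, X3]
        + cov_deriv \<A> \<Gamma> \<phi> p X2 [X0, X1, X3] - cov_deriv \<A> \<Gamma> \<phi> p X3 [X0, X1, X2]"
    by (simp add: X numeral_eq_Suc)
  show ?thesis
    unfolding ext cov alt G[of X1 X0] G[of X2 X0] G[of X3 X0] G[of X2 X1] G[of X3 X1] G[of X3 X2]
    using swap01[OF GT[of X0 X2] T(2) T(4)] swap01[OF GT[of X0 X3] T(2) T(3)]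
      swap12[OF T(2) GT[of X0 X3] T(3)]
      swap01[OF GT[of X1 X2] T(1) T(4)] swap01[OF GT[of X1 X3] T(1) T(3)] swap12[OF T(1) GT[of X1 X3] T(3)]
      swap01[OF GT[of X2 X3] T(1) T(2)] swap12[OF T(1) GT[of X2 X3] T(2)]
    by linarith
qed

text \<open>Alternation of the defining equation of the torsion: \<open>i\<close> transpositions carry \<open>T X\<^sub>i\<close> from the first
  slot to the slot \<open>i\<close> and absorb the sign \<open>(-1)\<^sup>i\<close>, so that
  \<open>\<nabla>\<^sub>X \<phi> = - \<psi> (T X, \<cdot>, \<cdot>, \<cdot>)\<close> leaves minus the derivation action of \<open>T\<close> on \<open>\<psi>\<close>.\<close>

lemma ext_deriv_eq_D_op_torsion:
  fixes \<A> :: "'m chart set"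
  assumes M: "oriented_manifold7 M \<A>" and p: "p \<in> points \<A>"
    and \<psi>: "diff_form \<A> 4 \<psi>" and \<phi>: "diff_form \<A> 3 \<phi>"
    and T: "intrinsic_torsion \<A> \<psi> g \<phi> T"
    and Xs: "Xs \<in> tlists \<A> 4 p"
  shows "ext_deriv \<A> \<phi> p Xs = D_op \<A> \<psi> T p Xs"
proof -
  obtain c where "c \<in> charts_at \<A> p"
    using p unfolding points_def charts_at_def by auto
  then interpret chart_point M \<A> p c using M by unfold_locales
  obtain \<Gamma> where lc: "levi_civita \<A> g \<Gamma>" and cov: "\<And>X Ys. X \<in> tangent \<Longrightarrow> Ys \<in> tlists \<A> 3 p \<Longrightarrow>
      cov_deriv \<A> \<Gamma> \<phi> p X Ys = - contract (T p X) \<psi> p Ys"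
    using T p unfolding intrinsic_torsion_def by blast
  have sym: "\<Gamma> c p u v = \<Gamma> c p v u" if "c \<in> charts_at \<A> p" for c u v
    using lc that unfolding levi_civita_def charts_at_def by blast
  have Tp: "fibre_endo \<A> p (T p)"
    using T p by (intro pointwise_endo_fibre) (simp_all add: intrinsic_torsion_def endo_field_def)
  obtain X0 X1 X2 X3 where X: "Xs = [X0, X1, X2, X3]"
    using Xs by (auto simp: tlists_def length_Suc_conv numeral_eq_Suc)
  have XT: "X0 \<in> tangent" "X1 \<in> tangent" "X2 \<in> tangent" "X3 \<in> tangent"
    using Xs by (simp_all add: X tlists_def)
  have TT: "T p X \<in> tangent" if "X \<in> tangent" for X using Tp that by (simp add: fibre_endo_def)
  have swap01: "\<psi> p [V, U, W, Z] = - \<psi> p [U, V, W, Z]" and swap12: "\<psi> p [U, W, V, Z] = - \<psi> p [U, V, W, Z]"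
    and swap23: "\<psi> p [U, V, Z, W] = - \<psi> p [U, V, W, Z]"
    if "U \<in> tangent" "V \<in> tangent" "W \<in> tangent" "Z \<in> tangent" for U V W Z
    using diff_form_swap[OF \<psi>, of "[U, V, W, Z]" 0 1] diff_form_swap[OF \<psi>, of "[U, V, W, Z]" 1 2]
      diff_form_swap[OF \<psi>, of "[U, V, W, Z]" 2 3] that
    by (simp_all add: tlists_def numeral_eq_Suc)
  have cov': "cov_deriv \<A> \<Gamma> \<phi> p X [U, V, W] = - \<psi> p [T p X, U, V, W]"
    if "X \<in> tangent" "U \<in> tangent" "V \<in> tangent" "W \<in> tangent" for X U V W
    using cov[of X "[U, V, W]"] that by (simp add: contract_def tlists_def)
  have "ext_deriv \<A> \<phi> p Xs = - \<psi> p [T p X0, X1, X2, X3] + \<psi> p [T p X1, X0, X2, X3]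
      - \<psi> p [T p X2, X0, X1, X3] + \<psi> p [T p X3, X0, X1, X2]"
    using ext_deriv_eq_cov_deriv[where \<Gamma> = \<Gamma>, OF M p sym \<phi> Xs]
    by (simp add: X numeral_eq_Suc cov' XT)
  also have "\<dots> = - (\<psi> p [T p X0, X1, X2, X3] + \<psi> p [X0, T p X1, X2, X3]
      + \<psi> p [X0, X1, T p X2, X3] + \<psi> p [X0, X1, X2, T p X3])"
    using swap01[of "T p X1" X0 X2 X3] swap01[of "T p X2" X0 X1 X3] swap12[of X0 "T p X2" X1 X3]
      swap01[of "T p X3" X0 X1 X2] swap12[of X0 "T p X3" X1 X2] swap23[of X0 X1 "T p X3" X2]
    by (simp add: XT TT)
  also have "\<dots> = D_op \<A> \<psi> T p Xs"
    using \<psi> D_op_eq[where E = T, OF _ Xs Tp, of \<psi>]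
    by (simp add: diff_form_def X numeral_eq_Suc)
  finally show ?thesis .
qed

theorem proposition3p1:
  fixes M :: "'m topology" and \<A> :: "'m chart set"
    and \<psi> :: "'m cotensor" and I :: "real set" and A :: "real \<Rightarrow> 'm endo"
    and \<psi>t g \<phi> :: "real \<Rightarrow> 'm cotensor" and T :: "real \<Rightarrow> 'm endo"
  assumes "oriented_manifold7 M \<A>"
    and "g2_structure \<A> \<psi>"
    and "open I" and "is_interval I"
    and "gauge_family \<A> I A"
    and "\<And>t. t \<in> I \<Longrightarrow> \<psi>t t = gauge_act \<A> (A t) \<psi>"
    and "\<And>t. t \<in> I \<Longrightarrow> g2_structure \<A> (\<psi>t t)"
    and "\<And>t. t \<in> I \<Longrightarrow> g2_metric \<A> (\<psi>t t) (g t)"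
    and "\<And>t. t \<in> I \<Longrightarrow> hodge_dual4 \<A> (g t) (\<psi>t t) (\<phi> t)"
    and "\<And>t. t \<in> I \<Longrightarrow> intrinsic_torsion \<A> (\<psi>t t) (g t) (\<phi> t) (T t)"
  shows "\<forall>t\<in>I. form_eq \<A> 4 (form_dot \<psi>t t) (ext_deriv \<A> (\<phi> t)) \<longleftrightarrow>
     form_eq \<A> 4 (D_op \<A> (\<psi>t t) (endo_compose (endo_dot A t) (gauge_inv \<A> (A t))))
               (D_op \<A> (\<psi>t t) (T t))"
proof
  fix t assume t: "t \<in> I"
  have form: "diff_form \<A> 4 \<psi>" "diff_form \<A> 4 (\<psi>t t)" "diff_form \<A> 3 (\<phi> t)"
    using assms(2) assms(7)[OF t] assms(9)[OF t] by (simp_all add: g2_structure_def hodge_dual4_def)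
  have tensor: "tensor_field \<A> 4 \<psi>" "tensor_field \<A> 4 (\<psi>t t)"
    using form(1,2) by (simp_all add: diff_form_def)
  have "form_dot \<psi>t t p Xs
      = D_op \<A> (\<psi>t t) (endo_compose (endo_dot A t) (gauge_inv \<A> (A t))) p Xs"
    and "ext_deriv \<A> (\<phi> t) p Xs = D_op \<A> (\<psi>t t) (T t) p Xs"
    if p: "p \<in> points \<A>" and Xs: "Xs \<in> tlists \<A> 4 p" for p Xs
  proof -
    obtain c where "c \<in> charts_at \<A> p"
      using p unfolding points_def charts_at_def by auto
    then interpret chart_point M \<A> p c using assms(1) by unfold_locales
    have "((\<lambda>s. gauge_act \<A> (A s) \<psi> p Xs) has_real_derivative
        D_op \<A> (\<psi>t t) (endo_compose (endo_dot A t) (gauge_inv \<A> (A t))) p Xs) (at t)"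
      using gauge_act_has_derivative[OF assms(5,3) t tensor(1) _ Xs] tensor(2)
      by (simp only: assms(6)[OF t])
    then have "((\<lambda>s. \<psi>t s p Xs) has_real_derivative
        D_op \<A> (\<psi>t t) (endo_compose (endo_dot A t) (gauge_inv \<A> (A t))) p Xs) (at t)"
      by (rule has_field_derivative_transform_within_open[OF _ assms(3) t]) (simp add: assms(6))
    then show "form_dot \<psi>t t p Xs
        = D_op \<A> (\<psi>t t) (endo_compose (endo_dot A t) (gauge_inv \<A> (A t))) p Xs"
      unfolding form_dot_def by (rule DERIV_imp_deriv)
    show "ext_deriv \<A> (\<phi> t) p Xs = D_op \<A> (\<psi>t t) (T t) p Xs"
      using assms(1) p form(2,3) assms(10)[OF t] Xs by (rule ext_deriv_eq_D_op_torsion)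
  qed
  then show "form_eq \<A> 4 (form_dot \<psi>t t) (ext_deriv \<A> (\<phi> t)) \<longleftrightarrow>
     form_eq \<A> 4 (D_op \<A> (\<psi>t t) (endo_compose (endo_dot A t) (gauge_inv \<A> (A t))))
               (D_op \<A> (\<psi>t t) (T t))"
    by (simp add: form_eq_def)
qed

end
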